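(* Let $\mathcal{S}\subset\mathcal{P}$ be a finite (nonempty) set of parameter values over which we want to estimate the error $\|u(\mu)-\widetilde u(\mu)\|_\Sigma$. Let $0<\delta<1$, $w>\sqrt{e}$ and assume that the integer $K$ satisfies $$K\geq\max\left\{\frac{\log(\#\mathcal{S})+\log(\delta^{-1})}{\log(w/\sqrt{e})},\ 3\right\}.$$ Then the fast-to-evaluate estimator $\widetilde\Delta(\mu)$ satisfies $$\mathbb{P}\Big\{(\alpha w)^{-1}\widetilde\Delta(\mu)\leq\|u(\mu)-\widetilde u(\mu)\|_\Sigma\leq(\alpha w)\,\widetilde\Delta(\mu),\ \ \forall\mu\in\mathcal{S}\Big\}\geq 1-\delta,$$ where $$\alpha:=\max_{\mu\in\mathcal{P}}\left(\max\left\{\frac{\Delta(\mu)}{\widetilde\Delta(\mu)},\ \frac{\widetilde\Delta(\mu)}{\Delta(\mu)}\right\}\right)\geq 1.$$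
   Context: Let $\mathcal{P}\subset\mathbb{R}^P$ be a parameter set. For every $\mu\in\mathcal{P}$, $A(\mu)\in\mathbb{R}^{N\times N}$ is invertible, $f(\mu)\in\mathbb{R}^N$, $u(\mu)\in\mathbb{R}^N$ solves $A(\mu)u(\mu)=f(\mu)$, $\widetilde u(\mu)\in\mathbb{R}^N$ is a given (deterministic) approximation of $u(\mu)$, and $r(\mu)=f(\mu)-A(\mu)\widetilde u(\mu)$ is the residual. $\Sigma\in\mathbb{R}^{N\times N}$ is symmetric positive semi-definite (not necessarily invertible) and $\|v\|_\Sigma^2=v^T\Sigma v$ for $v\in\mathbb{R}^N$. $Z_1,\ldots,Z_K$ are independent copies of $Z\sim\mathcal{N}(0,\Sigma)$. The random dual solutions $Y_i(\mu)\in\mathbb{R}^N$ solve $A(\mu)^TY_i(\mu)=Z_i$, $1\leq i\leq K$. $\widetilde{\mathcal{Y}}\subset\mathbb{R}^N$ is a linear subspace (the dual reduced space), in general a random subspace since it may be built from $Z_1,\ldots,Z_K$. $\widetilde Y_i(\mu)$ is the Galerkin projection of $Y_i(\mu)$ on $\widetilde{\mathcal{Y}}$: $\widetilde Y_i(\mu)\in\widetilde{\mathcal{Y}}$ and $\langle A(\mu)^T\widetilde Y_i(\mu),v\rangle=\langle Z_i,v\rangle$ for all $v\in\widetilde{\mathcal{Y}}$, where $\langle v,w\rangle=v^Tw$; this Galerkin problem is assumed to be uniquely solvable. Define $$\Delta(\mu)=\left(\frac1K\sum_{i=1}^K\big(Z_i^T(u(\mu)-\widetilde u(\mu))\big)^2\right)^{1/2}=\left(\frac1K\sum_{i=1}^K\big(Y_i(\mu)^Tr(\mu)\big)^2\right)^{1/2},$$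 $$\widetilde\Delta(\mu)=\left(\frac1K\sum_{i=1}^K\big(\widetilde Y_i(\mu)^Tr(\mu)\big)^2\right)^{1/2}.$$ The (random) number $\alpha$ is assumed to be well defined almost surely, i.e. $\Delta(\mu)$ and $\widetilde\Delta(\mu)$ are nonzero for $\mu\in\mathcal{P}$ and the maximum over $\mathcal{P}$ exists and is finite; $\alpha$ and $\widetilde\Delta(\mu)$ are assumed to be measurable. $\#\mathcal{S}$ denotes the cardinality of $\mathcal{S}$. *)

theory Defs
  imports "HOL-Probability.Probability"
begin

definition sym_pos_semidef :: "real^'n^'n \<Rightarrow> bool" where
  "sym_pos_semidef S \<longleftrightarrow> transpose S = S \<and> (\<forall>v. 0 \<le> v \<bullet> (S *v v))"

definition seminorm_of :: "real^'n^'n \<Rightarrow> real^'n \<Rightarrow> real" where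
  "seminorm_of S v = sqrt (v \<bullet> (S *v v))"

text \<open>
  The covariance matrix may be singular, so a Gaussian vector need not have a density.
  It is a random vector all of whose one-dimensional projections are normal or almost surely
  constant; \<open>m\<close> is its mean and \<open>S\<close> its covariance matrix. The integrals are never
  vacuous: the first clause makes all components square integrable.
\<close>
definition gaussian_vector ::
  "'w measure \<Rightarrow> real^'n \<Rightarrow> real^'n^'n \<Rightarrow> ('w \<Rightarrow> real^'n) \<Rightarrow> bool" where
  "gaussian_vector M m S X \<longleftrightarrow>
     X \<in> borel_measurable M \<and>
     (\<forall>v. (\<exists>c. AE \<omega> in M. v \<bullet> X \<omega> = c) \<or>
          (\<exists>a s. 0 < s \<and> distributed M lborel (\<lambda>\<omega>. v \<bullet> X \<omega>) (normal_density a s))) \<and>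
     (\<forall>i. (\<integral>\<omega>. X \<omega> $ i \<partial>M) = m $ i) \<and>
     (\<forall>i j. (\<integral>\<omega>. (X \<omega> $ i - m $ i) * (X \<omega> $ j - m $ j) \<partial>M) = S $ i $ j)"

text \<open>\<open>y\<close> solves the Galerkin problem on \<open>V\<close> for the linear system with matrix \<open>B\<close> and
  right-hand side \<open>z\<close>.\<close>
definition galerkin_solution ::
  "real^'n^'n \<Rightarrow> (real^'n) set \<Rightarrow> real^'n \<Rightarrow> real^'n \<Rightarrow> bool" where
  "galerkin_solution B V z y \<longleftrightarrow> y \<in> V \<and> (\<forall>v\<in>V. (B *v y) \<bullet> v = z \<bullet> v)"

definition residual ::
  "('p \<Rightarrow> real^'n^'n) \<Rightarrow> ('p \<Rightarrow> real^'n) \<Rightarrow> ('p \<Rightarrow> real^'n) \<Rightarrow> 'p \<Rightarrow> real^'n" where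
  "residual A f u' \<mu> = f \<mu> - A \<mu> *v u' \<mu>"

definition Delta ::
  "nat \<Rightarrow> (nat \<Rightarrow> 'w \<Rightarrow> real^'n) \<Rightarrow> ('p \<Rightarrow> real^'n) \<Rightarrow> ('p \<Rightarrow> real^'n) \<Rightarrow> 'p \<Rightarrow> 'w \<Rightarrow> real" where
  "Delta K Z u u' \<mu> \<omega> = sqrt (1 / real K * (\<Sum>i=1..K. (Z i \<omega> \<bullet> (u \<mu> - u' \<mu>))\<^sup>2))"

definition Delta_dual ::
  "nat \<Rightarrow> (nat \<Rightarrow> 'p \<Rightarrow> 'w \<Rightarrow> real^'n) \<Rightarrow> ('p \<Rightarrow> real^'n) \<Rightarrow> 'p \<Rightarrow> 'w \<Rightarrow> real" where
  "Delta_dual K Y r \<mu> \<omega> = sqrt (1 / real K * (\<Sum>i=1..K. (Y i \<mu> \<omega> \<bullet> r \<mu>)\<^sup>2))"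

lemma Delta_eq_Delta_dual:
  assumes "A \<mu> *v u \<mu> = f \<mu>"
    and "\<And>i. i \<in> {1..K} \<Longrightarrow> transpose (A \<mu>) *v Y i \<mu> \<omega> = Z i \<omega>"
  shows "Delta K Z u u' \<mu> \<omega> = Delta_dual K Y (residual A f u') \<mu> \<omega>"
proof -
  have "Z i \<omega> \<bullet> (u \<mu> - u' \<mu>) = Y i \<mu> \<omega> \<bullet> residual A f u' \<mu>" if "i \<in> {1..K}" for i
  proof -
    have "Z i \<omega> \<bullet> (u \<mu> - u' \<mu>) = (transpose (A \<mu>) *v Y i \<mu> \<omega>) \<bullet> (u \<mu> - u' \<mu>)"
      using assms(2)[OF that] by simp
    also have "\<dots> = Y i \<mu> \<omega> \<bullet> (A \<mu> *v (u \<mu> - u' \<mu>))"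
      by (metis dot_lmul_matrix transpose_matrix_vector)
    finally show ?thesis
      by (simp add: residual_def matrix_vector_mult_diff_distrib assms(1))
  qed
  then show ?thesis
    by (simp add: Delta_def Delta_dual_def)
qed

definition is_maximum :: "'a::linorder set \<Rightarrow> 'a \<Rightarrow> bool" where
  "is_maximum S m \<longleftrightarrow> m \<in> S \<and> (\<forall>x\<in>S. x \<le> m)"

end

theory Submission
  imports Defs
begin

text \<open>
  Fix a parameter \<open>\<mu>\<close>, write \<open>v\<close> for the error \<open>u \<mu> - u' \<mu>\<close> and \<open>s\<close> for its seminorm. The
  projections of the Gaussian vectors \<open>Z i\<close> onto \<open>v\<close> are independent centred normal variables of
  variance \<open>s\<^sup>2\<close>, so \<open>K \<Delta>\<^sup>2 / s\<^sup>2\<close> is a chi-square variable with \<open>K\<close> degrees of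
  freedom. The case \<open>s = 0\<close> cannot occur, because then \<open>\<Delta>\<close> would vanish almost surely.

  Chernoff's method bounds the probability that this variable exceeds \<open>K a\<close> (for \<open>a > 1\<close>) or falls
  below it (for \<open>a < 1\<close>) by the \<open>K\<close>-th power of \<open>sqrt a * exp ((1 - a)/2)\<close>. With \<open>a = w\<^sup>2\<close> and
  \<open>a = 1/w\<^sup>2\<close> the two bounds add up to at most \<open>(sqrt e / w) ^ K\<close>, which is where \<open>K \<ge> 3\<close> and
  \<open>w > sqrt e\<close> are used (\<open>chi_square_tail_bases_sum\<close>). Hence \<open>s / w \<le> \<Delta> \<le> w s\<close> fails with at most
  this probability (\<open>chi_square_concentration\<close>), and the lower bound on \<open>K\<close> says that the union
  over the finite set \<open>S\<close> of these failures has probability at most \<open>\<delta>\<close>.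

  Finally \<open>\<alpha>\<close> bounds the ratio of \<open>\<Delta>\<close> to its reduced version and its reciprocal pointwise and
  for all parameters at once. Passing to the reduced estimator therefore costs the factor \<open>\<alpha>\<close>
  and no probability.
\<close>

section \<open>A numerical inequality\<close>

text \<open>The constant \<open>27/10\<close> is close to the truth because the proof of the tail inequality below comes
  down to \<open>22 t + 6 \<le> 9 e t\<close> for \<open>t \<ge> e\<close>, whose worst case \<open>t = e\<close> needs
  \<open>e\<close> to be at least about \<open>2.692\<close>.\<close>
lemma exp_1_lower_bound: "(27/10 :: real) \<le> exp 1"
proof -
  have "(1 + 1/8 + (1/8)\<^sup>2 / 2 :: real) ^ 8 \<le> exp (1/8) ^ 8"
    by (intro power_mono exp_lower_Taylor_quadratic) auto
  also have "\<dots> = exp 1"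
    by (simp flip: exp_of_nat_mult)
  finally show ?thesis
    by (simp add: power2_eq_square field_simps eval_nat_numeral)
qed

text \<open>The tangent line of \<open>exp\<close> at \<open>1\<close>, rescaled. The rate is the least possible, with
  equality at \<open>x = e\<close>.\<close>
lemma le_exp_divide_exp_1: "x \<le> exp (x / exp 1)" for x :: real
proof -
  have "1 + (x / exp 1 - 1) \<le> exp (x / exp 1 - 1)"
    by (rule exp_ge_add_one_self)
  then show ?thesis
    unfolding exp_diff by (simp add: field_simps)
qed

text \<open>At \<open>t = e\<close> the left side is about \<open>0.92\<close>, so both summands need fairly sharp bounds. The second is at most
  \<open>1/(1 + 3/(2 t)) = 1 - 3/(2 t + 3)\<close>. It remains to see
  \<open>t\<^sup>3 (2 t + 3)/3 \<le> exp (3 t/2)\<close>, where \<open>x \<le> exp (x/e)\<close> is applied to each of the factors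
  \<open>t\<close> and \<open>(2 t + 3)/3\<close>, both of which are close to the tangent point \<open>e\<close> when \<open>t\<close> is.\<close>
lemma chi_square_tail_factors_sum_3:
  assumes t: "exp 1 \<le> (t::real)"
  shows "(t * exp (- t/2)) ^ 3 + exp (- 1 / (2*t)) ^ 3 \<le> 1"
proof -
  define e where "e = exp (1::real)"
  have e: "27/10 \<le> e" "0 < e" "e \<le> t" and t0: "0 < t"
    using exp_1_lower_bound t unfolding e_def by (auto intro: less_le_trans[of 0 "exp 1"])
  have "t ^ 3 * ((2*t+3)/3) \<le> exp (t / e) ^ 3 * exp ((2*t+3)/3 / e)"
    unfolding e_def using t0 by (intro mult_mono power_mono le_exp_divide_exp_1) auto
  also have "\<dots> = exp (3 * (t/e) + (2*t+3)/3 / e)"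
    by (simp add: exp_add flip: exp_of_nat_mult)
  also have "\<dots> \<le> exp (3 * t / 2)"
  proof -
    have "22 * t + 6 \<le> 9 * (t * e)"
    proof -
      have "t * (27/10) \<le> t * e" using e t0 by (intro mult_left_mono) auto
      then show ?thesis using e by argo
    qed
    then show ?thesis using e(2) by (simp add: field_simps)
  qed
  finally have 1: "t ^ 3 * exp (- (3 * t / 2)) \<le> 3 / (2*t+3)"
    using t0 by (simp add: exp_minus field_simps)
  have "exp (- (3 / (2*t))) \<le> 1 / (1 + 3 / (2*t))"
    using exp_ge_add_one_self[of "3/(2*t)"] t0
    unfolding exp_minus inverse_eq_divide by (intro divide_left_mono mult_pos_pos add_pos_pos) auto
  also have "\<dots> = 1 - 3 / (2*t+3)"
    using t0 by (simp add: field_simps)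
  finally have 2: "exp (- (3 / (2*t))) \<le> 1 - 3 / (2*t+3)" .
  have "(t * exp (- t/2)) ^ 3 = t ^ 3 * exp (- (3 * t / 2))"
    by (simp add: power_mult_distrib flip: exp_of_nat_mult)
  moreover have "exp (- 1 / (2*t)) ^ 3 = exp (- (3 / (2*t)))"
    by (simp flip: exp_of_nat_mult)
  ultimately show ?thesis
    using 1 2 by linarith
qed

text \<open>The Chernoff bound for a chi-square variable with \<open>n\<close> degrees of freedom at the threshold
  \<open>n a\<close> is the \<open>n\<close>-th power of this number, for the upper tail when \<open>a > 1\<close> and for the lower
  tail when \<open>a < 1\<close>.\<close>
definition chi_square_tail_base :: "real \<Rightarrow> real" where
  "chi_square_tail_base a = sqrt a * exp ((1 - a) / 2)"

text \<open>Relative to the base \<open>sqrt e / w\<close>, the two tails have bases \<open>p = t exp (-t/2)\<close> and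
  \<open>q = exp (-1/(2 t))\<close> with \<open>t = w\<^sup>2 > e\<close>. Both lie in \<open>[0, 1]\<close>, so their powers decrease in the
  exponent and \<open>K = 3\<close> is the worst case. This is how both tails together fit into a bound without
  a factor 2.\<close>
lemma chi_square_tail_bases_sum:
  assumes w: "sqrt (exp 1) < w" and K: "3 \<le> K"
  shows "chi_square_tail_base (w\<^sup>2) ^ K + chi_square_tail_base (1 / w\<^sup>2) ^ K
           \<le> (sqrt (exp 1) / w) ^ K"
proof -
  define t where "t = w\<^sup>2"
  have w0: "0 < w"
    using w by (rule le_less_trans[rotated]) simp
  have t: "exp 1 \<le> t"
    using w unfolding t_def by (metis less_eq_real_def sqrt_le_D)
  then have t0: "0 < t"
    by (rule less_le_trans[rotated]) simp
  have se: "sqrt (exp 1) = exp (1/2)"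
    by (rule real_sqrt_unique) (simp_all flip: exp_of_nat_mult)
  have st: "sqrt t = w" "w * w = t"
    using w0 by (simp_all add: t_def power2_eq_square)
  define p q where "p = t * exp (- t/2)" and "q = exp (- 1 / (2*t))"
  have pq0: "0 \<le> p" "0 \<le> q"
    using t0 by (simp_all add: p_def q_def)
  have pq3: "p ^ 3 + q ^ 3 \<le> 1"
    using chi_square_tail_factors_sum_3[OF t] by (simp add: p_def q_def)
  have "p ^ 3 \<le> 1" "q ^ 3 \<le> 1"
    using pq3 zero_le_power[OF pq0(1), of 3] zero_le_power[OF pq0(2), of 3] by linarith+
  then have pq1: "p \<le> 1" "q \<le> 1"
    by (simp_all add: power_le_one_iff pq0)
  have hp: "chi_square_tail_base t = sqrt (exp 1) / w * p"
  proof -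
    have "exp ((1 - t) / 2) = exp (1/2) * exp (- t/2)"
      by (simp add: diff_divide_distrib flip: exp_add)
    then show ?thesis
      using w0 by (simp add: chi_square_tail_base_def p_def se st(1) st(2)[symmetric])
  qed
  have hq: "chi_square_tail_base (1 / t) = sqrt (exp 1) / w * q"
  proof -
    have "exp ((1 - 1 / t) / 2) = exp (1/2) * exp (- 1 / (2*t))"
      by (simp add: diff_divide_distrib mult.commute flip: exp_add)
    then show ?thesis
      by (simp add: chi_square_tail_base_def q_def se real_sqrt_divide st(1))
  qed
  have "p ^ K + q ^ K \<le> p ^ 3 + q ^ 3"
    using pq0 pq1 K by (intro add_mono power_decreasing) auto
  then have "(sqrt (exp 1) / w) ^ K * (p ^ K + q ^ K) \<le> (sqrt (exp 1) / w) ^ K * 1"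
    using pq3 w0 by (intro mult_left_mono) auto
  then show ?thesis
    unfolding t_def[symmetric] hp hq by (simp only: power_mult_distrib distrib_left mult_1_right)
qed

section \<open>Concentration of a chi-square average\<close>

text \<open>The moment generating function \<open>(1 - 2 \<lambda>) powr (-1/2)\<close> of the square of a standard normal
  variable, with the parameter written as \<open>\<lambda> = (1 - 1/a)/2\<close>. In this form any \<open>a > 0\<close> is allowed,
  and the exponential tilt turns the centred normal density of deviation \<open>s\<close> into \<open>sqrt a\<close> times
  that of deviation \<open>sqrt a * s\<close>.\<close>
lemma (in prob_space) expectation_exp_square_normal:
  assumes X: "distributed M lborel X (normal_density 0 s)" and s: "0 < s" and a: "0 < (a::real)"
  shows "integrable M (\<lambda>\<omega>. exp ((1 - 1/a) / 2 * (X \<omega> / s)\<^sup>2))"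
    and "expectation (\<lambda>\<omega>. exp ((1 - 1/a) / 2 * (X \<omega> / s)\<^sup>2)) = sqrt a"
proof -
  have eq: "normal_density 0 s x * exp ((1 - 1/a) / 2 * (x / s)\<^sup>2)
              = sqrt a * normal_density 0 (sqrt a * s) x" for x
  proof -
    have "- (x\<^sup>2 / (2 * s\<^sup>2)) + (1 - 1/a) / 2 * (x / s)\<^sup>2 = - (x\<^sup>2 / (2 * (a * s\<^sup>2)))"
      using s a by (simp add: field_simps power2_eq_square)
    then show ?thesis
      using s a by (simp add: normal_density_def real_sqrt_mult
          exp_add[symmetric] field_simps)
  qed
  have sa: "0 < sqrt a * s"
    using s a by simp
  show "integrable M (\<lambda>\<omega>. exp ((1 - 1/a) / 2 * (X \<omega> / s)\<^sup>2))"
    by (subst distributed_integrable[OF X, symmetric])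
      (simp, simp, simp only: eq, rule integrable_mult_right,
        rule integrable_normal_density[OF sa])
  show "expectation (\<lambda>\<omega>. exp ((1 - 1/a) / 2 * (X \<omega> / s)\<^sup>2)) = sqrt a"
    by (subst distributed_integral[OF X, symmetric])
      (simp, simp, simp only: eq integral_mult_right_zero integral_normal_density[OF sa] mult_1_right)
qed

text \<open>Markov's inequality for the exponential of \<open>\<lambda>\<close> times the chi-square sum, where
  \<open>\<lambda> = (1 - 1/a)/2\<close> is the optimal Chernoff parameter for the threshold \<open>card I * a\<close>. Keeping the
  factor \<open>1 - 1/a\<close>, whose sign is that of \<open>a - 1\<close>, lets one statement cover the upper tail
  (\<open>a > 1\<close>) and the lower tail (\<open>a < 1\<close>).\<close>
lemma (in prob_space) chi_square_chernoff:
  assumes indep: "indep_vars (\<lambda>_. borel) X I" and I: "finite I"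
    and X: "\<And>i. i \<in> I \<Longrightarrow> distributed M lborel (X i) (normal_density 0 s)"
    and s: "0 < s" and a: "0 < (a::real)"
  shows "prob {\<omega> \<in> space M. (1 - 1/a) * (real (card I) * a) \<le> (1 - 1/a) * (\<Sum>i\<in>I. (X i \<omega> / s)\<^sup>2)}
           \<le> chi_square_tail_base a ^ card I"
proof -
  define E where "E i \<omega> = exp ((1 - 1/a) / 2 * (X i \<omega> / s)\<^sup>2)" for i \<omega>
  define c where "c = exp ((1 - 1/a) / 2 * (real (card I) * a))"
  have E_indep: "indep_vars (\<lambda>_. borel) E I"
    unfolding E_def by (rule indep_vars_compose2[OF indep]) simp
  have E: "integrable M (E i)" "expectation (E i) = sqrt a" if "i \<in> I" for i
    unfolding E_def using expectation_exp_square_normal[OF X[OF that] s a] by auto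
  have prod_E: "(\<Prod>i\<in>I. E i \<omega>) = exp ((1 - 1/a) / 2 * (\<Sum>i\<in>I. (X i \<omega> / s)\<^sup>2))" for \<omega>
    by (simp add: E_def exp_sum[OF I] sum_distrib_left)
  have "{\<omega> \<in> space M. (1 - 1/a) * (real (card I) * a) \<le> (1 - 1/a) * (\<Sum>i\<in>I. (X i \<omega> / s)\<^sup>2)}
          = {\<omega> \<in> space M. c \<le> (\<Prod>i\<in>I. E i \<omega>)}"
    unfolding prod_E c_def by auto
  also have "prob \<dots> \<le> expectation (\<lambda>\<omega>. \<Prod>i\<in>I. E i \<omega>) / c"
    by (rule integral_Markov_inequality_measure[where A="{}"])
      (rule indep_vars_integrable[OF I E_indep E(1)], simp_all add: c_def prod_E)
  also have "expectation (\<lambda>\<omega>. \<Prod>i\<in>I. E i \<omega>) = sqrt a ^ card I"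
    using E by (simp add: indep_vars_lebesgue_integral[OF I E_indep])
  also have "c = exp ((a - 1) / 2) ^ card I"
    using a by (simp add: c_def field_simps flip: exp_of_nat_mult)
  also have "sqrt a ^ card I / exp ((a - 1) / 2) ^ card I = chi_square_tail_base a ^ card I"
    unfolding chi_square_tail_base_def power_divide[symmetric]
    by (simp add: diff_divide_distrib exp_diff)
  finally show ?thesis .
qed

text \<open>A union of the two tail events, at the thresholds \<open>a = w\<^sup>2\<close> and \<open>a = 1/w\<^sup>2\<close>.\<close>
lemma (in prob_space) chi_square_concentration:
  assumes indep: "indep_vars (\<lambda>_. borel) X I" and I: "finite I" "3 \<le> card I"
    and X: "\<And>i. i \<in> I \<Longrightarrow> distributed M lborel (X i) (normal_density 0 s)"
    and s: "0 < s" and w: "sqrt (exp 1) < w"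
  shows "prob {\<omega> \<in> space M. \<not> (s \<le> w * sqrt (1 / card I * (\<Sum>i\<in>I. (X i \<omega>)\<^sup>2)) \<and>
                                  sqrt (1 / card I * (\<Sum>i\<in>I. (X i \<omega>)\<^sup>2)) \<le> w * s)}
           \<le> (sqrt (exp 1) / w) ^ card I"
proof -
  define Q where "Q \<omega> = (\<Sum>i\<in>I. (X i \<omega> / s)\<^sup>2)" for \<omega>
  define n where "n = real (card I)"
  define U where "U a = {\<omega> \<in> space M. (1 - 1/a) * (n * a) \<le> (1 - 1/a) * Q \<omega>}" for a
  have n: "0 < n"
    using I by (simp add: n_def)
  have "1 < sqrt (exp (1::real))"
    by simp
  with w have w1: "1 < w"
    by linarith
  have [measurable]: "X i \<in> borel_measurable M" if "i \<in> I" for i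
    using distributed_real_measurable[OF _ X[OF that]] distributed_measurable[OF X[OF that]] by simp
  have U_sets: "U a \<in> events" for a
    unfolding U_def Q_def by measurable
  have U: "prob (U a) \<le> chi_square_tail_base a ^ card I" if "0 < a" for a
    unfolding U_def Q_def n_def using I that by (intro chi_square_chernoff[OF indep _ X s]) auto
  have Q0: "0 \<le> Q \<omega>" for \<omega>
    by (simp add: Q_def sum_nonneg)
  have mean: "sqrt (1 / card I * (\<Sum>i\<in>I. (X i \<omega>)\<^sup>2)) = s * sqrt (Q \<omega> / n)" for \<omega>
  proof -
    have "(\<Sum>i\<in>I. (X i \<omega>)\<^sup>2) = s\<^sup>2 * Q \<omega>"
      using s by (simp add: Q_def power_divide sum_distrib_left)
    then show ?thesis
      using s by (simp add: n_def real_sqrt_mult real_sqrt_divide)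
  qed
  have "{\<omega> \<in> space M. \<not> (s \<le> w * sqrt (1 / card I * (\<Sum>i\<in>I. (X i \<omega>)\<^sup>2)) \<and>
            sqrt (1 / card I * (\<Sum>i\<in>I. (X i \<omega>)\<^sup>2)) \<le> w * s)} \<subseteq> U (w\<^sup>2) \<union> U (1 / w\<^sup>2)"
  proof
    fix \<omega>
    assume "\<omega> \<in> {\<omega> \<in> space M. \<not> (s \<le> w * sqrt (1 / card I * (\<Sum>i\<in>I. (X i \<omega>)\<^sup>2)) \<and>
            sqrt (1 / card I * (\<Sum>i\<in>I. (X i \<omega>)\<^sup>2)) \<le> w * s)}"
    then have \<omega>: "\<omega> \<in> space M"
      and "w * s < s * sqrt (Q \<omega> / n) \<or> w * (s * sqrt (Q \<omega> / n)) < s"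
      unfolding mean by auto
    then consider "w < sqrt (Q \<omega> / n)" | "sqrt (Q \<omega> / n) < 1 / w"
      using s w1 by (auto simp: field_simps)
    then show "\<omega> \<in> U (w\<^sup>2) \<union> U (1 / w\<^sup>2)"
    proof cases
      case 1
      then have "w\<^sup>2 < (sqrt (Q \<omega> / n))\<^sup>2"
        using w1 by (intro power_strict_mono) auto
      then have "n * w\<^sup>2 \<le> Q \<omega>"
        using Q0[of \<omega>] n by (simp add: field_simps)
      then have "(1 - 1 / w\<^sup>2) * (n * w\<^sup>2) \<le> (1 - 1 / w\<^sup>2) * Q \<omega>"
        using w1 by (intro mult_left_mono) auto
      then show ?thesis
        using \<omega> by (simp add: U_def)
    next
      case 2
      then have "(sqrt (Q \<omega> / n))\<^sup>2 < (1 / w)\<^sup>2"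
        using Q0[of \<omega>] n by (intro power_strict_mono) auto
      then have "Q \<omega> / n < 1 / w\<^sup>2"
        using Q0[of \<omega>] n by (simp add: power_divide)
      then have "Q \<omega> \<le> n * (1 / w\<^sup>2)"
        using n by (simp add: pos_divide_less_eq mult.commute)
      then have "(1 - 1 / (1 / w\<^sup>2)) * (n * (1 / w\<^sup>2)) \<le> (1 - 1 / (1 / w\<^sup>2)) * Q \<omega>"
        using w1 by (intro mult_left_mono_neg) auto
      then show ?thesis
        using \<omega> unfolding U_def by blast
    qed
  qed
  then have "prob {\<omega> \<in> space M. \<not> (s \<le> w * sqrt (1 / card I * (\<Sum>i\<in>I. (X i \<omega>)\<^sup>2)) \<and>
            sqrt (1 / card I * (\<Sum>i\<in>I. (X i \<omega>)\<^sup>2)) \<le> w * s)} \<le> prob (U (w\<^sup>2) \<union> U (1 / w\<^sup>2))"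
    using U_sets by (intro finite_measure_mono) auto
  also have "\<dots> \<le> prob (U (w\<^sup>2)) + prob (U (1 / w\<^sup>2))"
    using U_sets by (intro measure_Un_le)
  also have "\<dots> \<le> chi_square_tail_base (w\<^sup>2) ^ card I + chi_square_tail_base (1 / w\<^sup>2) ^ card I"
    using w1 by (intro add_mono U) auto
  also have "\<dots> \<le> (sqrt (exp 1) / w) ^ card I"
    by (rule chi_square_tail_bases_sum[OF w I(2)])
  finally show ?thesis .
qed

section \<open>Projections of Gaussian vectors\<close>

lemma (in prob_space) normal_square_integrable:
  assumes X: "distributed M lborel X (normal_density m s)" and s: "0 < s"
  shows "integrable M (\<lambda>\<omega>. (X \<omega>)\<^sup>2)"
proof -
  have [measurable]: "X \<in> borel_measurable M"
    using distributed_measurable[OF X] by simp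
  have "integrable M (\<lambda>\<omega>. (X \<omega> - m) ^ k)" for k :: nat
    using s integrable_normal_moment[OF s, of m k]
    by (subst distributed_integrable[OF X, symmetric]) simp_all
  from this[of 2] this[of 1] have "integrable M (\<lambda>\<omega>. (X \<omega> - m)\<^sup>2 + 2 * m * (X \<omega> - m) ^ 1 + m\<^sup>2)"
    by (intro Bochner_Integration.integrable_add integrable_mult_right) auto
  also have "(\<lambda>\<omega>. (X \<omega> - m)\<^sup>2 + 2 * m * (X \<omega> - m) ^ 1 + m\<^sup>2) = (\<lambda>\<omega>. (X \<omega>)\<^sup>2)"
    by (simp add: fun_eq_iff power2_eq_square algebra_simps)
  finally show ?thesis .
qed

lemma borel_measurable_vec_component:
  fixes X :: "'a \<Rightarrow> real^'n"
  assumes "X \<in> borel_measurable M"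
  shows "(\<lambda>\<omega>. X \<omega> $ i) \<in> borel_measurable M"
  using borel_measurable_inner[OF borel_measurable_const assms, of "axis i 1"]
  by (simp add: inner_axis')

text \<open>A component is the projection onto a coordinate axis, hence constant or normal. Square
  integrability makes the mean and covariance clauses of the definition usable in linear and
  quadratic combinations.\<close>
lemma (in prob_space) gaussian_vector_component_square_integrable:
  assumes "gaussian_vector M m S X"
  shows "integrable M (\<lambda>\<omega>. (X \<omega> $ i)\<^sup>2)"
proof -
  have "X \<in> borel_measurable M"
    using assms by (simp add: gaussian_vector_def)
  note [measurable] = borel_measurable_vec_component[OF this]
  have "(\<exists>c. AE \<omega> in M. axis i 1 \<bullet> X \<omega> = c) \<or>
      (\<exists>a s. 0 < s \<and> distributed M lborel (\<lambda>\<omega>. axis i 1 \<bullet> X \<omega>) (normal_density a s))"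
    using assms unfolding gaussian_vector_def by blast
  then consider c where "AE \<omega> in M. X \<omega> $ i = c"
    | a s where "0 < s" "distributed M lborel (\<lambda>\<omega>. X \<omega> $ i) (normal_density a s)"
    by (auto simp: inner_axis' )
  then show ?thesis
  proof cases
    case 1
    then have "AE \<omega> in M. (X \<omega> $ i)\<^sup>2 = c\<^sup>2"
      by auto
    then show ?thesis
      by (subst integrable_cong_AE[where g="\<lambda>_. c\<^sup>2"]) auto
  next
    case 2
    then show ?thesis
      by (intro normal_square_integrable)
  qed
qed

lemma (in prob_space) centered_gaussian_projection_moments:
  assumes G: "gaussian_vector M 0 S X"
  shows "expectation (\<lambda>\<omega>. v \<bullet> X \<omega>) = 0"
    and "expectation (\<lambda>\<omega>. (v \<bullet> X \<omega>)\<^sup>2) = v \<bullet> (S *v v)"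
    and "integrable M (\<lambda>\<omega>. (v \<bullet> X \<omega>)\<^sup>2)"
proof -
  have X [measurable]: "X \<in> borel_measurable M"
    using G by (simp add: gaussian_vector_def)
  note [measurable] = borel_measurable_vec_component[OF X]
  note sq = gaussian_vector_component_square_integrable[OF G]
  have int1: "integrable M (\<lambda>\<omega>. X \<omega> $ i)" for i
    by (rule square_integrable_imp_integrable[OF _ sq]) simp
  have int2: "integrable M (\<lambda>\<omega>. X \<omega> $ i * X \<omega> $ j)" for i j
  proof (rule Bochner_Integration.integrable_bound)
    show "integrable M (\<lambda>\<omega>. (X \<omega> $ i)\<^sup>2 + (X \<omega> $ j)\<^sup>2)"
      by (intro Bochner_Integration.integrable_add sq)
    have "\<bar>a * b\<bar> \<le> a\<^sup>2 + b\<^sup>2" for a b :: real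
    proof -
      have "2 * \<bar>a * b\<bar> \<le> a\<^sup>2 + b\<^sup>2"
        using sum_squares_bound[of "\<bar>a\<bar>" "\<bar>b\<bar>"] by (simp add: abs_mult mult.assoc)
      then show ?thesis
        using abs_ge_zero[of "a * b"] by linarith
    qed
    then show "AE \<omega> in M. norm (X \<omega> $ i * X \<omega> $ j) \<le> norm ((X \<omega> $ i)\<^sup>2 + (X \<omega> $ j)\<^sup>2)"
      by simp
  qed simp
  have E1: "expectation (\<lambda>\<omega>. X \<omega> $ i) = 0" and E2: "expectation (\<lambda>\<omega>. X \<omega> $ i * X \<omega> $ j) = S $ i $ j" for i j
    using G by (simp_all add: gaussian_vector_def)
  show "expectation (\<lambda>\<omega>. v \<bullet> X \<omega>) = 0"
    by (simp add: inner_vec_def int1 E1)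
  have eq: "(v \<bullet> X \<omega>)\<^sup>2 = (\<Sum>i\<in>UNIV. \<Sum>j\<in>UNIV. v $ i * v $ j * (X \<omega> $ i * X \<omega> $ j))" for \<omega>
    by (simp add: inner_vec_def power2_eq_square sum_product algebra_simps)
  show "integrable M (\<lambda>\<omega>. (v \<bullet> X \<omega>)\<^sup>2)"
    unfolding eq by (intro Bochner_Integration.integrable_sum integrable_mult_right int2)
  have "expectation (\<lambda>\<omega>. (v \<bullet> X \<omega>)\<^sup>2) = (\<Sum>i\<in>UNIV. \<Sum>j\<in>UNIV. v $ i * v $ j * S $ i $ j)"
    unfolding eq by (simp add: int2 E2)
  also have "\<dots> = v \<bullet> (S *v v)"
    by (simp add: inner_vec_def matrix_vector_mult_def sum_distrib_left algebra_simps)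
  finally show "expectation (\<lambda>\<omega>. (v \<bullet> X \<omega>)\<^sup>2) = v \<bullet> (S *v v)" .
qed

lemma (in prob_space) centered_gaussian_projection_degenerate:
  assumes G: "gaussian_vector M 0 S X" and v: "v \<bullet> (S *v v) = 0"
  shows "AE \<omega> in M. v \<bullet> X \<omega> = 0"
proof -
  have "AE \<omega> in M. (v \<bullet> X \<omega>)\<^sup>2 = 0"
    using centered_gaussian_projection_moments(2,3)[OF G, of v] v
    by (subst integral_nonneg_eq_0_iff_AE[symmetric]) auto
  then show ?thesis
    by simp
qed

text \<open>The law is determined by its mean and variance. The almost surely constant alternative
  is excluded because its constant would be the mean \<open>0\<close>, which contradicts the positive
  variance.\<close>
lemma (in prob_space) centered_gaussian_projection_normal:
  assumes G: "gaussian_vector M 0 S X" and v: "0 < v \<bullet> (S *v v)"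
  shows "distributed M lborel (\<lambda>\<omega>. v \<bullet> X \<omega>) (normal_density 0 (seminorm_of S v))"
proof -
  note mom = centered_gaussian_projection_moments[OF G, of v]
  have [measurable]: "X \<in> borel_measurable M"
    using G by (simp add: gaussian_vector_def)
  consider c where "AE \<omega> in M. v \<bullet> X \<omega> = c"
    | a s where "0 < s" "distributed M lborel (\<lambda>\<omega>. v \<bullet> X \<omega>) (normal_density a s)"
    using G unfolding gaussian_vector_def by blast
  then show ?thesis
  proof cases
    case 1
    have "expectation (\<lambda>\<omega>. v \<bullet> X \<omega>) = expectation (\<lambda>\<omega>. c)"
      by (rule integral_cong_AE) (use 1 in auto)
    with mom(1) have "c = 0"
      by (simp add: prob_space)
    have "expectation (\<lambda>\<omega>. (v \<bullet> X \<omega>)\<^sup>2) = expectation (\<lambda>\<omega>. c\<^sup>2)"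
      by (rule integral_cong_AE) (use 1 in auto)
    with mom(2) v \<open>c = 0\<close> show ?thesis
      by simp
  next
    case 2
    have "a = 0"
      using normal_distributed_expectation[OF 2] mom(1) by simp
    moreover have "s\<^sup>2 = v \<bullet> (S *v v)"
      using normal_distributed_variance[OF 2] mom(1,2) by simp
    then have "s = seminorm_of S v"
      using 2(1) by (simp add: seminorm_of_def flip: real_sqrt_unique)
    ultimately show ?thesis
      using 2(2) by simp
  qed
qed

section \<open>Certification of the estimator\<close>

theorem proposition3p3:
  fixes M :: "'w measure"
    and P S :: "(real^'p) set"
    and A :: "real^'p \<Rightarrow> real^'n^'n"
    and f u u' :: "real^'p \<Rightarrow> real^'n"
    and \<Sigma> :: "real^'n^'n"
    and K :: nat
    and Z :: "nat \<Rightarrow> 'w \<Rightarrow> real^'n"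
    and Y Y' :: "nat \<Rightarrow> real^'p \<Rightarrow> 'w \<Rightarrow> real^'n"
    and V :: "'w \<Rightarrow> (real^'n) set"
    and \<alpha> :: "'w \<Rightarrow> real"
    and \<delta> w :: real
  assumes "prob_space M"
    and "\<And>\<mu>. \<mu> \<in> P \<Longrightarrow> invertible (A \<mu>)"
    and "\<And>\<mu>. \<mu> \<in> P \<Longrightarrow> A \<mu> *v u \<mu> = f \<mu>"
    and "sym_pos_semidef \<Sigma>"
    and "\<And>i. i \<in> {1..K} \<Longrightarrow> gaussian_vector M 0 \<Sigma> (Z i)"
    and "prob_space.indep_vars M (\<lambda>_. borel) Z {1..K}"
    and "\<And>i \<mu> \<omega>. \<lbrakk>i \<in> {1..K}; \<mu> \<in> P; \<omega> \<in> space M\<rbrakk> \<Longrightarrow> transpose (A \<mu>) *v Y i \<mu> \<omega> = Z i \<omega>"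
    and "\<And>\<omega>. \<omega> \<in> space M \<Longrightarrow> subspace (V \<omega>)"
    and "AE \<omega> in M. \<forall>\<mu>\<in>P. \<forall>i\<in>{1..K}.
           (\<exists>!y. galerkin_solution (transpose (A \<mu>)) (V \<omega>) (Z i \<omega>) y) \<and>
           galerkin_solution (transpose (A \<mu>)) (V \<omega>) (Z i \<omega>) (Y' i \<mu> \<omega>)"
    and "\<And>\<mu>. \<mu> \<in> P \<Longrightarrow> Delta_dual K Y' (residual A f u') \<mu> \<in> borel_measurable M"
    and "AE \<omega> in M. \<forall>\<mu>\<in>P. Delta K Z u u' \<mu> \<omega> \<noteq> 0 \<and> Delta_dual K Y' (residual A f u') \<mu> \<omega> \<noteq> 0"
    and "AE \<omega> in M. is_maximum
           ((\<lambda>\<mu>. max (Delta K Z u u' \<mu> \<omega> / Delta_dual K Y' (residual A f u') \<mu> \<omega>)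
                     (Delta_dual K Y' (residual A f u') \<mu> \<omega> / Delta K Z u u' \<mu> \<omega>)) ` P) (\<alpha> \<omega>)"
    and "\<alpha> \<in> borel_measurable M"
    and "finite S" and "S \<noteq> {}" and "S \<subseteq> P"
    and "0 < \<delta>" and "\<delta> < 1" and "w > sqrt (exp 1)"
    and "real K \<ge> max ((ln (real (card S)) + ln (inverse \<delta>)) / ln (w / sqrt (exp 1))) 3"
  shows "measure M {\<omega> \<in> space M. \<forall>\<mu>\<in>S.
           inverse (\<alpha> \<omega> * w) * Delta_dual K Y' (residual A f u') \<mu> \<omega> \<le> seminorm_of \<Sigma> (u \<mu> - u' \<mu>) \<and>
           seminorm_of \<Sigma> (u \<mu> - u' \<mu>) \<le> (\<alpha> \<omega> * w) * Delta_dual K Y' (residual A f u') \<mu> \<omega>} \<ge> 1 - \<delta>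
       \<and> (AE \<omega> in M. \<alpha> \<omega> \<ge> 1)"
proof -
  interpret prob_space M
    by fact
  define D where "D = Delta K Z u u'"
  define D' where "D' = Delta_dual K Y' (residual A f u')"
  define v where "v \<mu> = u \<mu> - u' \<mu>" for \<mu>
  define s where "s \<mu> = seminorm_of \<Sigma> (v \<mu>)" for \<mu>
  note gauss = assms(5) and indep = assms(6)
  have D'_measurable [measurable]: "D' \<mu> \<in> borel_measurable M" if "\<mu> \<in> P" for \<mu>
    using assms(10)[OF that] by (simp add: D'_def)
  note [measurable] = \<open>\<alpha> \<in> borel_measurable M\<close>
  have K: "3 \<le> K" and K_ln: "(ln (real (card S)) + ln (inverse \<delta>)) / ln (w / sqrt (exp 1)) \<le> real K"
    using assms(20) by auto
  have w: "sqrt (exp 1) < w"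
    by fact
  moreover have "0 < sqrt (exp (1::real))"
    by simp
  ultimately have w0: "0 < w"
    by linarith
  have D_mean: "D \<mu> \<omega> = sqrt (1 / card {1..K} * (\<Sum>i=1..K. (v \<mu> \<bullet> Z i \<omega>)\<^sup>2))" for \<mu> \<omega>
    by (simp add: D_def Delta_def v_def inner_commute)

  \<comment> \<open>The error has positive seminorm at each parameter: otherwise all projections vanish almost
    surely, and then so does \<open>D \<mu>\<close>, against the assumption that it is nonzero.\<close>
  have s_pos: "0 < v \<mu> \<bullet> (\<Sigma> *v v \<mu>)" if \<mu>: "\<mu> \<in> P" for \<mu>
  proof (rule ccontr)
    assume "\<not> 0 < v \<mu> \<bullet> (\<Sigma> *v v \<mu>)"
    with \<open>sym_pos_semidef \<Sigma>\<close> have "v \<mu> \<bullet> (\<Sigma> *v v \<mu>) = 0"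
      by (metis sym_pos_semidef_def order_le_less)
    then have "AE \<omega> in M. v \<mu> \<bullet> Z i \<omega> = 0" if "i \<in> {1..K}" for i
      using centered_gaussian_projection_degenerate[OF gauss[OF that]] by simp
    then have "AE \<omega> in M. \<forall>i\<in>{1..K}. v \<mu> \<bullet> Z i \<omega> = 0"
      by (simp add: AE_finite_all)
    then have "AE \<omega> in M. D \<mu> \<omega> = 0"
      by eventually_elim (simp add: D_mean)
    with assms(11) have "AE \<omega> in M. False"
      by eventually_elim (use \<mu> in \<open>auto simp: D_def\<close>)
    then show False
      by simp
  qed

  \<comment> \<open>The probability bound concerns only \<open>D\<close>, whose direction \<open>v \<mu>\<close> is deterministic. The
    reduced space may depend on the \<open>Z i\<close> in any way, since \<open>D'\<close> is compared to \<open>D\<close> pointwise by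
    \<open>\<alpha>\<close>.\<close>
  define bad where "bad \<mu> = {\<omega> \<in> space M. \<not> (s \<mu> \<le> w * D \<mu> \<omega> \<and> D \<mu> \<omega> \<le> w * s \<mu>)}" for \<mu>
  have bad_prob: "prob (bad \<mu>) \<le> (sqrt (exp 1) / w) ^ K" if \<mu>: "\<mu> \<in> P" for \<mu>
  proof -
    have "indep_vars (\<lambda>_. borel) (\<lambda>i \<omega>. v \<mu> \<bullet> Z i \<omega>) {1..K}"
      by (rule indep_vars_compose2[OF indep]) simp
    moreover have "distributed M lborel (\<lambda>\<omega>. v \<mu> \<bullet> Z i \<omega>) (normal_density 0 (s \<mu>))"
      if "i \<in> {1..K}" for i
      unfolding s_def by (rule centered_gaussian_projection_normal[OF gauss[OF that] s_pos[OF \<mu>]])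
    moreover have "0 < s \<mu>"
      using s_pos[OF \<mu>] by (simp add: s_def seminorm_of_def)
    ultimately show ?thesis
      using chi_square_concentration[of "\<lambda>i \<omega>. v \<mu> \<bullet> Z i \<omega>" "{1..K}" "s \<mu>" w] K w
      unfolding bad_def D_mean by simp
  qed
  have bad_events: "bad \<mu> \<in> events" for \<mu>
  proof -
    have [measurable]: "(\<lambda>\<omega>. v \<mu> \<bullet> Z i \<omega>) \<in> borel_measurable M" if "i \<in> {1..K}" for i
      using gauss[OF that] by (auto simp: gaussian_vector_def)
    show ?thesis
      unfolding bad_def D_mean by measurable
  qed

  have "prob (\<Union>\<mu>\<in>S. bad \<mu>) \<le> (\<Sum>\<mu>\<in>S. prob (bad \<mu>))"
    using \<open>finite S\<close> bad_events by (intro finite_measure_subadditive_finite) auto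
  also have "\<dots> \<le> (\<Sum>\<mu>\<in>S. (sqrt (exp 1) / w) ^ K)"
    using \<open>S \<subseteq> P\<close> by (intro sum_mono bad_prob) auto
  also have "\<dots> = real (card S) * (sqrt (exp 1) / w) ^ K"
    by simp
  also have "\<dots> \<le> \<delta>"
  proof -
    have S: "0 < real (card S)"
      using \<open>finite S\<close> \<open>S \<noteq> {}\<close> by (simp add: card_gt_0_iff)
    define \<rho> where "\<rho> = w / sqrt (exp 1)"
    have \<rho>: "1 < \<rho>"
      using w by (simp add: \<rho>_def)
    have "ln (real (card S) * inverse \<delta>) \<le> ln (\<rho> ^ K)"
      using K_ln \<rho> S \<open>0 < \<delta>\<close> unfolding \<rho>_def[symmetric]
      by (simp add: pos_divide_le_eq ln_mult ln_realpow)
    then have "real (card S) * inverse \<delta> \<le> \<rho> ^ K"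
      using \<rho> S \<open>0 < \<delta>\<close> by (subst (asm) ln_le_cancel_iff) auto
    moreover have "(sqrt (exp 1) / w) ^ K = inverse (\<rho> ^ K)"
      by (simp add: \<rho>_def power_inverse[symmetric])
    ultimately show ?thesis
      using \<rho> \<open>0 < \<delta>\<close> by (simp add: field_simps)
  qed
  finally have bad_S: "prob (\<Union>\<mu>\<in>S. bad \<mu>) \<le> \<delta>" .

  \<comment> \<open>\<open>1 \<le> \<alpha>\<close> because a positive ratio and its reciprocal cannot both be below \<open>1\<close>.\<close>
  have \<alpha>: "AE \<omega> in M. (\<forall>\<mu>\<in>P. D \<mu> \<omega> \<le> \<alpha> \<omega> * D' \<mu> \<omega> \<and> D' \<mu> \<omega> \<le> \<alpha> \<omega> * D \<mu> \<omega>) \<and> 1 \<le> \<alpha> \<omega>"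
    using assms(11,12)
  proof eventually_elim
    case (elim \<omega>)
    have pos: "0 < D \<mu> \<omega>" "0 < D' \<mu> \<omega>" if "\<mu> \<in> P" for \<mu>
    proof -
      have "0 \<le> D \<mu> \<omega>" "0 \<le> D' \<mu> \<omega>"
        by (simp_all add: D_def D'_def Delta_def Delta_dual_def sum_nonneg)
      with elim(1) that show "0 < D \<mu> \<omega>" "0 < D' \<mu> \<omega>"
        by (auto simp: D_def D'_def order_less_le)
    qed
    have ratio: "D \<mu> \<omega> / D' \<mu> \<omega> \<le> \<alpha> \<omega>" "D' \<mu> \<omega> / D \<mu> \<omega> \<le> \<alpha> \<omega>" if "\<mu> \<in> P" for \<mu>
      using elim(2) that unfolding is_maximum_def D_def D'_def by auto
    have "D \<mu> \<omega> \<le> \<alpha> \<omega> * D' \<mu> \<omega> \<and> D' \<mu> \<omega> \<le> \<alpha> \<omega> * D \<mu> \<omega>" if "\<mu> \<in> P" for \<mu>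
      using ratio[OF that] pos[OF that] by (simp add: pos_divide_le_eq)
    moreover obtain \<mu> where \<mu>: "\<mu> \<in> P"
      using \<open>S \<noteq> {}\<close> \<open>S \<subseteq> P\<close> by auto
    have "1 \<le> \<alpha> \<omega>"
    proof (cases "D \<mu> \<omega> \<le> D' \<mu> \<omega>")
      case True
      then have "1 \<le> D' \<mu> \<omega> / D \<mu> \<omega>"
        using pos[OF \<mu>] by simp
      with ratio(2)[OF \<mu>] show ?thesis
        by simp
    next
      case False
      then have "1 \<le> D \<mu> \<omega> / D' \<mu> \<omega>"
        using pos[OF \<mu>] by simp
      with ratio(1)[OF \<mu>] show ?thesis
        by simp
    qed
    ultimately show ?case
      by blast
  qed

  define good where "good = {\<omega> \<in> space M. \<forall>\<mu>\<in>S.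
      inverse (\<alpha> \<omega> * w) * D' \<mu> \<omega> \<le> s \<mu> \<and> s \<mu> \<le> (\<alpha> \<omega> * w) * D' \<mu> \<omega>}"
  have "good \<in> events"
    unfolding good_def using \<open>finite S\<close> \<open>S \<noteq> {}\<close> \<open>S \<subseteq> P\<close> D'_measurable
    by (intro sets.sets_Collect_finite_All') (auto simp: subset_iff)
  have "1 - \<delta> \<le> 1 - prob (\<Union>\<mu>\<in>S. bad \<mu>)"
    using bad_S by simp
  also have "\<dots> = prob (space M - (\<Union>\<mu>\<in>S. bad \<mu>))"
    using bad_events \<open>finite S\<close> by (intro prob_compl[symmetric]) auto
  also have "\<dots> \<le> prob good"
  proof (rule finite_measure_mono_AE[OF _ \<open>good \<in> events\<close>])
    show "AE \<omega> in M. \<omega> \<in> space M - (\<Union>\<mu>\<in>S. bad \<mu>) \<longrightarrow> \<omega> \<in> good"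
      using \<alpha>
    proof eventually_elim
      case (elim \<omega>)
      show ?case
      proof
        assume \<omega>: "\<omega> \<in> space M - (\<Union>\<mu>\<in>S. bad \<mu>)"
        have "inverse (\<alpha> \<omega> * w) * D' \<mu> \<omega> \<le> s \<mu> \<and> s \<mu> \<le> (\<alpha> \<omega> * w) * D' \<mu> \<omega>" if "\<mu> \<in> S" for \<mu>
        proof -
          have D: "s \<mu> \<le> w * D \<mu> \<omega>" "D \<mu> \<omega> \<le> w * s \<mu>"
            using \<omega> that by (auto simp: bad_def)
          have a: "D \<mu> \<omega> \<le> \<alpha> \<omega> * D' \<mu> \<omega>" "D' \<mu> \<omega> \<le> \<alpha> \<omega> * D \<mu> \<omega>" "1 \<le> \<alpha> \<omega>"
            using elim that \<open>S \<subseteq> P\<close> by auto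
          have "D' \<mu> \<omega> \<le> \<alpha> \<omega> * (w * s \<mu>)"
            using a D by (meson order_trans mult_left_mono zero_le_one)
          moreover have "s \<mu> \<le> w * (\<alpha> \<omega> * D' \<mu> \<omega>)"
            using a D w0 by (meson order_trans mult_left_mono less_imp_le)
          ultimately show ?thesis
            using a(3) w0 by (simp add: field_simps)
        qed
        with \<omega> show "\<omega> \<in> good"
          by (simp add: good_def)
      qed
    qed
  qed
  finally have "1 - \<delta> \<le> prob good" .
  moreover have "AE \<omega> in M. 1 \<le> \<alpha> \<omega>"
    using \<alpha> by eventually_elim simp
  ultimately show ?thesis
    by (simp add: good_def D'_def s_def v_def)
qed

end
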